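(* Let $p\equiv 3\pmod 4$ be a prime, let $t$ be a positive integer, and let $q=p^{2t}$. Then the number of cliques of order $3$ in the Peisert graph $P^\ast(q)$ is $$k_3(P^\ast(q))=\frac{q(q-1)(q-5)}{48}.$$
   Context: Let $g$ be a primitive element of $\mathbb{F}_q$ (so $\mathbb{F}_q^\ast=\langle g\rangle$). The Peisert graph $P^\ast(q)$ is the graph with vertex set $\mathbb{F}_q$ in which $a\neq b$ are adjacent if and only if $a-b\in\langle g^4\rangle\cup g\langle g^4\rangle$ (this is independent of the choice of $g$ and is symmetric since $-1\in\langle g^4\rangle$). A clique of order $m$ is a set of $m$ vertices that are pairwise adjacent; $k_m(G)$ denotes the number of cliques of order $m$ in a graph $G$. *)

theory Defs
  imports Complex_Main "HOL-Library.Cardinality" "HOL-Computational_Algebra.Primes"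
begin

text \<open>A simple graph is given by its vertex set and its adjacency relation.\<close>

definition clique :: "'v set \<Rightarrow> ('v \<Rightarrow> 'v \<Rightarrow> bool) \<Rightarrow> nat \<Rightarrow> 'v set \<Rightarrow> bool" where
  "clique V adj m C \<longleftrightarrow>
     C \<subseteq> V \<and> finite C \<and> card C = m \<and> (\<forall>a\<in>C. \<forall>b\<in>C. a \<noteq> b \<longrightarrow> adj a b)"

definition num_cliques :: "nat \<Rightarrow> 'v set \<Rightarrow> ('v \<Rightarrow> 'v \<Rightarrow> bool) \<Rightarrow> nat" where
  "num_cliques m V adj = card {C. clique V adj m C}"

text \<open>For \<open>x \<noteq> 0\<close> the following set is the cyclic subgroup of the multiplicative group
  generated by \<open>x\<close>.\<close>

definition cyclic_subgroup :: "'a::field \<Rightarrow> 'a set" where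
  "cyclic_subgroup x = range (\<lambda>k::int. x powi k)"

definition primitive_element :: "'a::field \<Rightarrow> bool" where
  "primitive_element g \<longleftrightarrow> g \<noteq> 0 \<and> cyclic_subgroup g = UNIV - {0}"

text \<open>The adjacency relation of the Peisert graph with respect to \<open>g\<close>; its vertex set is the
  whole field. It is symmetric when \<open>-1 \<in> \<langle>g\<^sup>4\<rangle>\<close>, which holds for primitive \<open>g\<close> whenever the
  order of the field is the square of an odd number.\<close>

definition peisert_adj :: "'a::field \<Rightarrow> 'a \<Rightarrow> 'a \<Rightarrow> bool" where
  "peisert_adj g a b \<longleftrightarrow>
     a \<noteq> b \<and> a - b \<in> cyclic_subgroup (g ^ 4) \<union> (\<lambda>x. g * x) ` cyclic_subgroup (g ^ 4)"

end

theory Submission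
  imports Defs
begin

text \<open>Multiplication by \<open>g\<^sup>2\<close> exchanges \<open>\<langle>g\<^sup>4\<rangle> \<union> g\<langle>g\<^sup>4\<rangle>\<close> with its complement in the group
  of units, so the Peisert graph is isomorphic to its complement and is regular of degree
  \<open>(q - 1) / 2\<close>. By Goodman's formula, the numbers of triangles in a regular graph and in its
  complement have a sum that depends only on the order and the degree; half of this sum is the
  claimed value.\<close>

section \<open>Triangles in a regular graph and its complement\<close>

lemma card_orderings_three:
  assumes "card C = 3"
  shows "card {(a, b, c). {a, b, c} = C} = 6"
proof -
  obtain x y z where C: "C = {x, y, z}" and d: "x \<noteq> y" "y \<noteq> z" "x \<noteq> z"
    using assms by (auto simp: card_3_iff)
  have "{(a, b, c). {a, b, c} = C} =
      {(x, y, z), (x, z, y), (y, x, z), (y, z, x), (z, x, y), (z, y, x)}"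
      (is "?L = ?R")
  proof (intro equalityI subsetI)
    fix u assume "u \<in> ?L"
    then obtain a b c where u: "u = (a, b, c)" and abc: "{a, b, c} = {x, y, z}"
      by (auto simp: C)
    have "a \<in> {x, y, z}" "b \<in> {x, y, z}" "c \<in> {x, y, z}"
      "x \<in> {a, b, c}" "y \<in> {a, b, c}" "z \<in> {a, b, c}"
      using abc by blast+
    then show "u \<in> ?R" using d unfolding u by auto
  qed (auto simp: C)
  then show ?thesis using d by simp
qed

text \<open>Irreflexivity forces the entries of such a triple to be distinct, so the triples are
  exactly the orderings of the cliques of order 3; different cliques have disjoint sets of
  orderings, of size 6 each.\<close>

lemma ordered_triangles:
  assumes fin: "finite V"
    and sym: "\<And>a b. a \<in> V \<Longrightarrow> b \<in> V \<Longrightarrow> adj a b \<Longrightarrow> adj b a"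
    and irr: "\<And>a. a \<in> V \<Longrightarrow> \<not> adj a a"
  shows "card {(a, b, c). a \<in> V \<and> b \<in> V \<and> c \<in> V \<and> adj a b \<and> adj b c \<and> adj c a}
           = 6 * num_cliques 3 V adj"
proof -
  let ?K = "{C. clique V adj 3 C}" and ?O = "\<lambda>C. {(a, b, c). {a, b, c} = C}"
  have finK: "finite ?K"
    by (rule finite_subset[of _ "Pow V"]) (auto simp: clique_def fin)
  have six: "card (?O C) = 6" if "C \<in> ?K" for C
    using that by (intro card_orderings_three) (auto simp: clique_def)
  have "{(a, b, c). a \<in> V \<and> b \<in> V \<and> c \<in> V \<and> adj a b \<and> adj b c \<and> adj c a} = (\<Union>C\<in>?K. ?O C)"
  proof -
    have "clique V adj 3 {a, b, c} \<longleftrightarrow>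
        a \<in> V \<and> b \<in> V \<and> c \<in> V \<and> adj a b \<and> adj b c \<and> adj c a" (is "?L \<longleftrightarrow> ?R") for a b c
    proof
      assume L: ?L
      then have "card {a, b, c} = 3" by (simp add: clique_def)
      then have "a \<noteq> b" "b \<noteq> c" "c \<noteq> a"
        by (auto simp: card_insert_if split: if_splits)
      with L show ?R by (auto simp: clique_def)
    next
      assume R: ?R
      then have "a \<noteq> b" "b \<noteq> c" "c \<noteq> a" using irr by auto
      with R show ?L by (auto simp: clique_def intro: sym)
    qed
    then show ?thesis by auto
  qed
  also have "card \<dots> = (\<Sum>C\<in>?K. card (?O C))"
  proof (rule card_UN_disjoint[OF finK])
    \<comment> \<open>An infinite set has \<open>card\<close> equal to 0, so cardinality 6 already
      implies finiteness.\<close>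
    show "\<forall>C\<in>?K. finite (?O C)"
      using six by (metis card.infinite zero_neq_numeral)
  qed auto
  also have "\<dots> = 6 * card ?K" using six by simp
  finally show ?thesis by (simp add: num_cliques_def)
qed

text \<open>A product of real indicators, unlike a cardinality, can be expanded algebraically when
  passing to the complement.\<close>

lemma ordered_triangles_sum:
  assumes "finite V"
    and "\<And>a b. a \<in> V \<Longrightarrow> b \<in> V \<Longrightarrow> adj a b \<Longrightarrow> adj b a"
    and "\<And>a. a \<in> V \<Longrightarrow> \<not> adj a a"
  shows "(\<Sum>a\<in>V. \<Sum>b\<in>V. \<Sum>c\<in>V. of_bool (adj a b) * of_bool (adj b c) * of_bool (adj c a))
           = 6 * real (num_cliques 3 V adj)"
proof -
  have "(\<Sum>a\<in>V. \<Sum>b\<in>V. \<Sum>c\<in>V. of_bool (adj a b) * of_bool (adj b c) * of_bool (adj c a))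
      = (\<Sum>(a, b, c)\<in>V \<times> V \<times> V. of_bool (adj a b \<and> adj b c \<and> adj c a) :: real)"
    by (simp add: sum.cartesian_product of_bool_conj mult.assoc)
  also have "\<dots> = (\<Sum>x\<in>V \<times> V \<times> V.
      of_bool (x \<in> {(a, b, c). adj a b \<and> adj b c \<and> adj c a}))"
    by (intro sum.cong) auto
  also have "\<dots> = real (card (V \<times> V \<times> V \<inter> {(a, b, c). adj a b \<and> adj b c \<and> adj c a}))"
    using assms(1) by (subst sum_of_bool_eq) simp_all
  also have "V \<times> V \<times> V \<inter> {(a, b, c). adj a b \<and> adj b c \<and> adj c a} =
      {(a, b, c). a \<in> V \<and> b \<in> V \<and> c \<in> V \<and> adj a b \<and> adj b c \<and> adj c a}"
    by auto
  finally show ?thesis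
    using ordered_triangles[of V adj, OF assms] by simp
qed

text \<open>In matrix terms, let \<open>e\<close> be the adjacency matrix and \<open>h\<close> the
  all-ones matrix minus the identity, so that the complement has matrix \<open>h - e\<close>. The
  sum of the traces of the two cubes loses its cubic term in \<open>e\<close>, leaving tr(hhh) - 3
  tr(ehh) + 3 tr(eeh). Regularity makes each of these depend only on \<open>n\<close> and
  \<open>d\<close>.\<close>

lemma goodman_regular:
  fixes adj :: "'v \<Rightarrow> 'v \<Rightarrow> bool"
  assumes fin: "finite V"
    and sym: "\<And>a b. a \<in> V \<Longrightarrow> b \<in> V \<Longrightarrow> adj a b \<Longrightarrow> adj b a"
    and irr: "\<And>a. a \<in> V \<Longrightarrow> \<not> adj a a"
    and reg: "\<And>a. a \<in> V \<Longrightarrow> card {b \<in> V. adj a b} = d"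
    and n: "card V = n"
  shows "6 * (real (num_cliques 3 V adj) + real (num_cliques 3 V (\<lambda>a b. a \<noteq> b \<and> \<not> adj a b)))
     = real n * (real n - 1) * (real n - 2) - 3 * real n * real d * (real n - 2)
       + 3 * real n * real d * (real d - 1)"
proof -
  define e where "e a b = (of_bool (adj a b) :: real)" for a b
  define i where "i a b = (of_bool (a = b) :: real)" for a b :: 'v
  have e_sym: "e a b = e b a" if "a \<in> V" "b \<in> V" for a b
    using sym that by (auto simp: e_def)
  have deg: "(\<Sum>b\<in>V. e a b) = real d" if "a \<in> V" for a
    using fin reg[OF that] by (simp add: e_def Int_def)
  have delta: "(\<Sum>b\<in>V. i a b * f b) = f a" "(\<Sum>b\<in>V. i b a * f b) = f a" if "a \<in> V" for a f
    using fin that by (auto simp: i_def of_bool_def if_distrib[of "\<lambda>x. x * _"] cong: if_cong)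
  define h where "h a b = 1 - i a b" for a b
  \<comment> \<open>This counts the vertices \<open>c\<close> different from both \<open>a\<close>
    and \<open>b\<close>: there is one more of them when \<open>a = b\<close>.\<close>
  have hh: "(\<Sum>c\<in>V. h b c * h c a) = real n - 2 + i a b" if "a \<in> V" "b \<in> V" for a b
  proof -
    \<comment> \<open>The factors \<open>1\<close> give every term the shape that
      \<open>delta\<close> expects.\<close>
    have "(\<Sum>c\<in>V. h b c * h c a) = (\<Sum>c\<in>V. 1 - i b c * 1 - i c a * 1 + i b c * i c a)"
      by (simp add: h_def algebra_simps)
    also have "\<dots> = real n - 1 - 1 + i b a"
      using that by (simp only: sum.distrib sum_subtractf delta) (simp add: n)
    finally show ?thesis by (simp add: i_def eq_commute)
  qed
  \<comment> \<open>This counts the neighbours of \<open>b\<close> other than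
    \<open>a\<close>.\<close>
  have eh: "(\<Sum>c\<in>V. e b c * h c a) = real d - e a b" if "a \<in> V" "b \<in> V" for a b
  proof -
    have "(\<Sum>c\<in>V. e b c * h c a) = (\<Sum>c\<in>V. e b c - i c a * e b c)"
      by (simp add: h_def algebra_simps)
    also have "\<dots> = real d - e b a"
      using that by (simp only: sum_subtractf delta deg)
    finally show ?thesis using e_sym that by simp
  qed
  let ?S = "\<lambda>F. \<Sum>a\<in>V. \<Sum>b\<in>V. \<Sum>c\<in>V. (F a b c :: real)"
  \<comment> \<open>Cyclic relabelling of the summation variables; it identifies the three mixed
    terms of each kind in the expansion.\<close>
  have rot: "?S F = ?S (\<lambda>a b c. F b c a)" for F
  proof -
    have "?S (\<lambda>a b c. F b c a) = (\<Sum>b\<in>V. \<Sum>a\<in>V. \<Sum>c\<in>V. F b c a)"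
      by (rule sum.swap)
    also have "\<dots> = ?S F"
      by (intro sum.cong refl sum.swap)
    finally show ?thesis by simp
  qed
  have hhh: "?S (\<lambda>a b c. h a b * (h b c * h c a)) = real n * (real n - 1) * (real n - 2)"
  proof -
    \<comment> \<open>The term \<open>i a b\<close> from \<open>hh\<close> does not contribute,
      because \<open>h\<close> vanishes on the diagonal.\<close>
    have "?S (\<lambda>a b c. h a b * (h b c * h c a)) =
        (\<Sum>a\<in>V. \<Sum>b\<in>V. (real n - 2) - i a b * (real n - 2))"
      by (intro sum.cong refl, simp only: sum_distrib_left[symmetric] hh)
        (auto simp: h_def i_def)
    also have "\<dots> = (\<Sum>a\<in>V. (real n - 1) * (real n - 2))"
      by (intro sum.cong refl, simp only: sum_subtractf delta) (simp add: n algebra_simps)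
    finally show ?thesis by (simp add: n)
  qed
  have ehh: "?S (\<lambda>a b c. e a b * (h b c * h c a)) = real n * real d * (real n - 2)"
  proof -
    have "?S (\<lambda>a b c. e a b * (h b c * h c a)) = (\<Sum>a\<in>V. \<Sum>b\<in>V. e a b * (real n - 2))"
      by (intro sum.cong refl, simp only: sum_distrib_left[symmetric] hh)
        (auto simp: e_def i_def irr)
    also have "\<dots> = (\<Sum>a\<in>V. real d * (real n - 2))"
      by (intro sum.cong refl, simp only: sum_distrib_right[symmetric] deg)
    finally show ?thesis by (simp add: n)
  qed
  have eeh: "?S (\<lambda>a b c. e a b * (e b c * h c a)) = real n * real d * (real d - 1)"
  proof -
    \<comment> \<open>Since \<open>e\<close> takes only the values 0 and 1, it equals its square,
      which turns the factor \<open>real d - e a b\<close> into \<open>real d - 1\<close>.\<close>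
    have "?S (\<lambda>a b c. e a b * (e b c * h c a)) = (\<Sum>a\<in>V. \<Sum>b\<in>V. e a b * (real d - 1))"
      by (intro sum.cong refl, simp only: sum_distrib_left[symmetric] eh) (auto simp: e_def)
    also have "\<dots> = (\<Sum>a\<in>V. real d * (real d - 1))"
      by (intro sum.cong refl, simp only: sum_distrib_right[symmetric] deg)
    finally show ?thesis by (simp add: n)
  qed
  have "6 * (real (num_cliques 3 V adj) + real (num_cliques 3 V (\<lambda>a b. a \<noteq> b \<and> \<not> adj a b)))
      = ?S (\<lambda>a b c. e a b * e b c * e c a)
        + ?S (\<lambda>a b c. (h a b - e a b) * (h b c - e b c) * (h c a - e c a))"
  proof -
    \<comment> \<open>By irreflexivity both \<open>h\<close> and \<open>e\<close> vanish on the
      diagonal, so \<open>h - e\<close> is the indicator of adjacency in the complement.\<close>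
    have "?S (\<lambda>a b c. (h a b - e a b) * (h b c - e b c) * (h c a - e c a)) =
        ?S (\<lambda>a b c. of_bool (a \<noteq> b \<and> \<not> adj a b) * of_bool (b \<noteq> c \<and> \<not> adj b c)
          * of_bool (c \<noteq> a \<and> \<not> adj c a))"
      by (intro sum.cong refl arg_cong2[where f = "(*)"]) (auto simp: h_def i_def e_def irr)
    moreover have "\<dots> = 6 * real (num_cliques 3 V (\<lambda>a b. a \<noteq> b \<and> \<not> adj a b))"
      using sym by (intro ordered_triangles_sum fin) auto
    moreover have "?S (\<lambda>a b c. e a b * e b c * e c a) = 6 * real (num_cliques 3 V adj)"
      unfolding e_def using sym irr by (intro ordered_triangles_sum fin)
    ultimately show ?thesis by simp
  qed
  \<comment> \<open>Expanding the second product, the cubic term in \<open>e\<close> cancels the first sum.\<close>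
  also have "\<dots> = ?S (\<lambda>a b c. h a b * (h b c * h c a))
      - (?S (\<lambda>a b c. e a b * (h b c * h c a)) + ?S (\<lambda>a b c. e b c * (h c a * h a b))
        + ?S (\<lambda>a b c. e c a * (h a b * h b c)))
      + (?S (\<lambda>a b c. e a b * (e b c * h c a)) + ?S (\<lambda>a b c. e b c * (e c a * h a b))
        + ?S (\<lambda>a b c. e c a * (e a b * h b c)))"
    by (simp only: sum.distrib[symmetric] sum_subtractf[symmetric])
      (intro sum.cong refl, simp add: algebra_simps)
  also have "\<dots> = real n * (real n - 1) * (real n - 2) - 3 * real n * real d * (real n - 2)
       + 3 * real n * real d * (real d - 1)"
    using rot[of "\<lambda>a b c. e a b * (h b c * h c a)"] rot[of "\<lambda>a b c. e b c * (h c a * h a b)"]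
      rot[of "\<lambda>a b c. e a b * (e b c * h c a)"] rot[of "\<lambda>a b c. e b c * (e c a * h a b)"]
    by (simp only: hhh ehh eeh)
  finally show ?thesis .
qed

text \<open>Taking images under \<open>f\<close> permutes the subsets of \<open>V\<close> and
  matches the cliques of the two relations. It is used to compare a graph with its complement on the
  same vertex set.\<close>

lemma num_cliques_iso:
  assumes bij: "bij_betw f V V"
    and adj: "\<And>a b. a \<in> V \<Longrightarrow> b \<in> V \<Longrightarrow> adj' (f a) (f b) \<longleftrightarrow> adj a b"
  shows "num_cliques m V adj' = num_cliques m V adj"
proof -
  have inj: "inj_on f V" and im: "f ` V = V"
    using bij by (auto simp: bij_betw_def)
  have iff: "clique V adj' m (f ` C) \<longleftrightarrow> clique V adj m C" if "C \<subseteq> V" for C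
  proof -
    have "inj_on f C" using inj that by (rule inj_on_subset)
    then have "card (f ` C) = card C" "finite (f ` C) \<longleftrightarrow> finite C"
      "\<And>a b. a \<in> C \<Longrightarrow> b \<in> C \<Longrightarrow> f a = f b \<longleftrightarrow> a = b"
      by (auto simp: card_image finite_image_iff inj_on_def)
    moreover have "f ` C \<subseteq> V" using that im by blast
    ultimately show ?thesis
      using that adj by (auto simp: clique_def subset_iff)
  qed
  have "{C. clique V adj' m C} = image f ` {C. clique V adj m C}"
  proof (intro equalityI subsetI)
    fix D assume D: "D \<in> {C. clique V adj' m C}"
    then have "D \<subseteq> f ` V" by (simp add: clique_def im)
    then obtain C where "C \<subseteq> V" "D = f ` C" by (auto simp: subset_image_iff)
    with D iff show "D \<in> image f ` {C. clique V adj m C}" by auto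
  next
    fix D assume "D \<in> image f ` {C. clique V adj m C}"
    then obtain C where "D = f ` C" "clique V adj m C" by auto
    moreover from this have "C \<subseteq> V" by (simp add: clique_def)
    ultimately show "D \<in> {C. clique V adj' m C}" using iff by auto
  qed
  moreover have "inj_on (image f) {C. clique V adj m C}"
    by (rule inj_on_subset[OF inj_on_image_Pow[OF inj]]) (auto simp: clique_def)
  ultimately show ?thesis
    by (simp add: num_cliques_def card_image)
qed

section \<open>The Peisert graph\<close>

text \<open>Let \<open>m\<close> be the multiplicative order of \<open>g\<close>. The powers with
  exponents below \<open>m\<close> are distinct, and reducing exponents modulo \<open>m\<close>
  shows that they exhaust the units; hence \<open>m\<close> is the number of units.\<close>

lemma primitive_element_powi_eq_1_iff:
  fixes g :: "'a::{field,finite}"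
  assumes "primitive_element g"
  shows "g powi k = 1 \<longleftrightarrow> int (CARD('a) - 1) dvd k"
proof -
  have g0: "g \<noteq> 0" and gen: "range (\<lambda>k::int. g powi k) = UNIV - {0}"
    using assms by (auto simp: primitive_element_def cyclic_subgroup_def)
  \<comment> \<open>Pigeonhole in a finite field: two powers coincide, so some positive power is
    1.\<close>
  have "\<not> inj (\<lambda>n::nat. g ^ n)"
    using finite_imageD[of "\<lambda>n::nat. g ^ n" UNIV] by auto
  then obtain i j where "i < j" "g ^ i = g ^ j"
    unfolding inj_def by (metis linorder_neqE_nat)
  then have "0 < j - i \<and> g ^ (j - i) = 1"
    using g0 by (simp add: power_diff)
  then have ex: "\<exists>n>0. g ^ n = 1" by blast
  define m where "m = (LEAST n. n > 0 \<and> g ^ n = 1)"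
  have m: "m > 0" "g ^ m = 1"
    using LeastI_ex[OF ex] by (auto simp: m_def)
  have least: "\<not> (0 < n \<and> g ^ n = 1)" if "n < m" for n
    using not_less_Least[of n "\<lambda>n. n > 0 \<and> g ^ n = 1"] that by (simp add: m_def)
  \<comment> \<open>The remainder is nonnegative even for negative \<open>k\<close>, so
    \<open>nat\<close> loses nothing.\<close>
  have red: "g powi k = g ^ nat (k mod int m)" for k
  proof -
    have "g powi k = g powi (int m * (k div int m) + k mod int m)" by simp
    also have "\<dots> = (g powi int m) powi (k div int m) * g powi (k mod int m)"
      using g0 by (subst power_int_add) (simp_all add: power_int_mult)
    also have "\<dots> = g ^ nat (k mod int m)"
      using m by (simp add: power_int_def)
    finally show ?thesis .
  qed
  have one: "g powi k = 1 \<longleftrightarrow> int m dvd k" for k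
  proof
    assume "g powi k = 1"
    then have "\<not> 0 < nat (k mod int m)"
      using least[of "nat (k mod int m)"] m(1) by (auto simp: red nat_less_iff)
    then have "k mod int m = 0"
      using m(1) pos_mod_sign[of "int m" k] by linarith
    then show "int m dvd k" by auto
  qed (simp add: red)
  have "inj_on (\<lambda>n. g ^ n) {..<m}"
  proof (rule linorder_inj_onI)
    fix x y assume "x < y" "x \<in> {..<m}" "y \<in> {..<m}"
    then have "g ^ (y - x) \<noteq> 1" using least[of "y - x"] by auto
    then show "g ^ x \<noteq> g ^ y" using g0 \<open>x < y\<close> by (simp add: power_diff)
  qed auto
  moreover have "(\<lambda>n. g ^ n) ` {..<m} = UNIV - {0}"
  proof (intro equalityI subsetI)
    fix x :: 'a assume "x \<in> UNIV - {0}"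
    then obtain k where "x = g powi k" using gen by blast
    then have "x = g ^ nat (k mod int m)" by (simp add: red)
    moreover have "nat (k mod int m) < m" using m(1) by (simp add: nat_less_iff)
    ultimately show "x \<in> (\<lambda>n. g ^ n) ` {..<m}" by blast
  qed (use g0 in auto)
  ultimately have "m = card (UNIV - {0 :: 'a})"
    using card_image by fastforce
  then have "m = CARD('a) - 1" by simp
  with one show ?thesis by simp
qed

text \<open>This power squares to 1 but is not 1, as its exponent is positive and smaller than the
  order of \<open>g\<close>; the only other square root of 1 in a field is -1.\<close>

lemma primitive_element_powi_half:
  fixes g :: "'a::{field,finite}"
  assumes g: "primitive_element g" and odd: "odd (CARD('a))" and gt: "CARD('a) > 1"
  shows "g powi (int ((CARD('a) - 1) div 2)) = -1"
proof -
  define h where "h = (CARD('a) - 1) div 2"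
  have h: "CARD('a) - 1 = 2 * h" "h > 0"
    using odd gt by (auto simp: h_def elim!: oddE)
  have "g powi (int h * 2) = 1"
    unfolding primitive_element_powi_eq_1_iff[OF g] h by simp
  then have "(g powi int h)\<^sup>2 = 1"
    by (simp add: power_int_mult)
  moreover have "g powi int h \<noteq> 1"
    using primitive_element_powi_eq_1_iff[OF g, of "int h"] h by (auto dest: zdvd_imp_le)
  ultimately show ?thesis
    by (simp add: h_def power2_eq_1_iff)
qed

text \<open>Exponents of \<open>g\<close> are determined modulo \<open>CARD('a) - 1\<close>, a
  multiple of 4, so their residue modulo 4 is well defined and decides membership.\<close>

lemma peisert_powi_mem_iff:
  fixes g :: "'a::{field,finite}"
  assumes g: "primitive_element g" and dvd: "4 dvd CARD('a) - 1"
  shows "g powi k \<in> cyclic_subgroup (g ^ 4) \<union> (\<lambda>x. g * x) ` cyclic_subgroup (g ^ 4)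
    \<longleftrightarrow> k mod 4 \<in> {0, 1}"
proof -
  have g0: "g \<noteq> 0" using g by (simp add: primitive_element_def)
  have eq: "g powi k = g powi l \<longleftrightarrow> int (CARD('a) - 1) dvd k - l" for k l
    using primitive_element_powi_eq_1_iff[OF g, of "k - l"] g0
    by (simp add: power_int_diff)
  have "int 4 dvd int (CARD('a) - 1)" using dvd by (simp only: of_nat_dvd_iff)
  then have mod: "k mod 4 = l mod 4" if "g powi k = g powi l" for k l
    using that dvd_trans by (fastforce simp: eq mod_eq_dvd_iff)
  have pow4: "(g ^ 4) powi j = g powi (4 * j)" for j
    by (simp add: power_int_mult)
  have pow41: "g * g powi (4 * j) = g powi (4 * j + 1)" for j
    using g0 by (simp add: power_int_add)
  show ?thesis
  proof
    assume "g powi k \<in> cyclic_subgroup (g ^ 4) \<union> (\<lambda>x. g * x) ` cyclic_subgroup (g ^ 4)"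
    then obtain j where "g powi k = g powi (4 * j) \<or> g powi k = g powi (4 * j + 1)"
      by (fastforce simp: cyclic_subgroup_def pow4 pow41)
    then show "k mod 4 \<in> {0, 1}" using mod by fastforce
  next
    assume "k mod 4 \<in> {0, 1}"
    then have "k = 4 * (k div 4) \<or> k = 4 * (k div 4) + 1"
      by (simp only: insert_iff empty_iff) presburger
    then have "g powi k = (g ^ 4) powi (k div 4) \<or> g powi k = g * (g ^ 4) powi (k div 4)"
      by (metis pow4 pow41)
    then show "g powi k \<in> cyclic_subgroup (g ^ 4) \<union> (\<lambda>x. g * x) ` cyclic_subgroup (g ^ 4)"
      unfolding cyclic_subgroup_def by blast
  qed
qed

text \<open>With \<open>q\<close> the order of the field, Goodman's formula for degree (q - 1)/2
  gives q(q - 1)(q - 5)/4 as six times the joint triangle count; self-complementarity makes that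
  count twice the wanted number.\<close>

lemma num_cliques_peisert:
  fixes g :: "'a::{field,finite}"
  assumes g: "primitive_element g" and dvd: "8 dvd CARD('a) - 1"
    and gt: "CARD('a) > 1"
  shows "48 * real (num_cliques 3 UNIV (peisert_adj g))
    = real CARD('a) * (real CARD('a) - 1) * (real CARD('a) - 5)"
proof -
  define S where "S = cyclic_subgroup (g ^ 4) \<union> (\<lambda>x. g * x) ` cyclic_subgroup (g ^ 4)"
  have g0: "g \<noteq> 0" using g by (simp add: primitive_element_def)
  obtain r where r: "CARD('a) - 1 = 8 * r" using dvd by (elim dvdE)
  have q: "CARD('a) = 8 * r + 1" using r gt by linarith
  have S: "g powi k \<in> S \<longleftrightarrow> k mod 4 \<in> {0, 1}" for k
    unfolding S_def by (rule peisert_powi_mem_iff[OF g]) (unfold r, simp)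
  have ex: "\<exists>k. x = g powi k" if "x \<noteq> 0" for x
    using g that by (auto simp: primitive_element_def cyclic_subgroup_def set_eq_iff)
  have zero: "0 \<notin> S"
    using g0 by (auto simp: S_def cyclic_subgroup_def)
  \<comment> \<open>Divisibility by 8 enters here: half of the group order is a multiple of 4, so
    negation preserves exponents modulo 4 and hence \<open>S\<close>.\<close>
  have "g powi int (4 * r) = -1"
    using primitive_element_powi_half[OF g] q gt by simp
  then have neg_powi: "- (g powi k) = g powi (k + 4 * int r)" for k
    using g0 by (simp add: power_int_add)
  have minus: "- x \<in> S \<longleftrightarrow> x \<in> S" for x
  proof (cases "x = 0")
    case False
    then obtain k where "x = g powi k" using ex by blast
    then show ?thesis by (simp add: S neg_powi)
  qed simp
  \<comment> \<open>Adding 2 to the exponent exchanges the residues 0, 1 with 2, 3.\<close>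
  have compl: "g\<^sup>2 * x \<in> S \<longleftrightarrow> x \<notin> S" if x: "x \<noteq> 0" for x
  proof -
    obtain k where k: "x = g powi k" using ex[OF x] by blast
    have "g powi (k + 2) = g powi k * g powi 2"
      using g0 by (intro power_int_add) simp
    then have "g\<^sup>2 * x = g powi (k + 2)"
      by (simp add: k mult.commute)
    moreover have "(k + 2) mod 4 \<in> {0, 1} \<longleftrightarrow> k mod 4 \<notin> {0, 1}"
      by (simp only: insert_iff empty_iff) presburger
    ultimately show ?thesis by (simp only: S k)
  qed
  have adj: "peisert_adj g a b \<longleftrightarrow> a - b \<in> S" for a b
    using zero by (auto simp: peisert_adj_def S_def)
  have bij: "bij (\<lambda>x. g\<^sup>2 * x)"
    by (rule bij_betw_byWitness[where f' = "\<lambda>x. x / g\<^sup>2"]) (use g0 in auto)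
  have iso: "peisert_adj g (g\<^sup>2 * a) (g\<^sup>2 * b) \<longleftrightarrow> a \<noteq> b \<and> \<not> peisert_adj g a b" for a b
    using compl[of "a - b"] zero by (cases "a = b") (auto simp: adj right_diff_distrib[symmetric])
  \<comment> \<open>Multiplication by \<open>g\<^sup>2\<close> maps the units outside
    \<open>S\<close> bijectively onto \<open>S\<close>, so \<open>S\<close> holds half of the
    \<open>8 * r\<close> units.\<close>
  have "card S = 4 * r"
  proof -
    have "(\<lambda>x. g\<^sup>2 * x) ` (UNIV - {0} - S) = S"
    proof (intro equalityI subsetI)
      fix y assume y: "y \<in> S"
      then have "y \<noteq> 0" using zero by auto
      moreover have "y = g\<^sup>2 * (y / g\<^sup>2)" using g0 by simp
      ultimately show "y \<in> (\<lambda>x. g\<^sup>2 * x) ` (UNIV - {0} - S)"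
        using y compl[of "y / g\<^sup>2"] g0 by (intro image_eqI[where x = "y / g\<^sup>2"]) auto
    qed (use compl in blast)
    moreover have "inj_on (\<lambda>x. g\<^sup>2 * x) (UNIV - {0} - S)"
      using g0 by (auto simp: inj_on_def)
    ultimately have "card S = card (UNIV - {0} - S)"
      using card_image by metis
    also have "\<dots> = 8 * r - card S"
      using zero by (subst card_Diff_subset) (auto simp: q)
    finally have "card S = 8 * r - card S" .
    moreover have "card S \<le> card (UNIV - {0 :: 'a})"
      using zero by (intro card_mono) auto
    ultimately show ?thesis by (simp add: r)
  qed
  \<comment> \<open>Each neighbourhood is a reflected translate of \<open>S\<close>, so the degree
    is \<open>card S\<close>.\<close>
  moreover have "{b. peisert_adj g a b} = (\<lambda>x. a - x) ` S" for a
  proof -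
    have "b \<in> (\<lambda>x. a - x) ` S" if "a - b \<in> S" for b
      using that by (intro image_eqI[where x = "a - b"]) auto
    then show ?thesis by (auto simp: adj)
  qed
  ultimately have deg: "card {b \<in> UNIV. peisert_adj g a b} = 4 * r" for a
    by (simp add: card_image inj_on_def)
  have "peisert_adj g b a" if "peisert_adj g a b" for a b
    using that minus[of "a - b"] by (simp add: adj)
  moreover have "\<not> peisert_adj g a a" for a by (simp add: peisert_adj_def)
  ultimately have "6 * (real (num_cliques 3 UNIV (peisert_adj g))
      + real (num_cliques 3 UNIV (\<lambda>a b. a \<noteq> b \<and> \<not> peisert_adj g a b)))
    = real CARD('a) * (real CARD('a) - 1) * (real CARD('a) - 2)
      - 3 * real CARD('a) * real (4 * r) * (real CARD('a) - 2)
      + 3 * real CARD('a) * real (4 * r) * (real (4 * r) - 1)"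
    using deg by (intro goodman_regular) auto
  moreover have "num_cliques 3 UNIV (peisert_adj g)
      = num_cliques 3 UNIV (\<lambda>a b. a \<noteq> b \<and> \<not> peisert_adj g a b)"
    using bij iso by (intro num_cliques_iso[where f = "\<lambda>x. g\<^sup>2 * x"])
  ultimately show ?thesis
    by (simp add: q algebra_simps)
qed

theorem theorem1p1:
  fixes p t q :: nat
    and g :: "'a::{field,finite}"
  assumes "prime p" and "p mod 4 = 3" and "t > 0" and "q = p ^ (2 * t)"
    and "CARD('a) = q"
    and "primitive_element g"
  shows "real (num_cliques 3 (UNIV :: 'a set) (peisert_adj g))
           = real q * (real q - 1) * (real q - 5) / 48"
proof -
  have "odd p" using assms(2) by presburger
  then have "odd (p ^ t)" by simp
  then obtain s where s: "p ^ t = 2 * s + 1" by (elim oddE)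
  \<comment> \<open>As the square of the odd number \<open>2 * s + 1\<close>, \<open>q\<close>
    exceeds 1 by four times a product of consecutive integers; that product is even, so 8 divides
    \<open>q - 1\<close>.\<close>
  have "q = (p ^ t)\<^sup>2" using assms(4) by (simp add: power_mult[symmetric] mult.commute)
  then have q: "q - 1 = 4 * (s * (s + 1))" by (simp add: s power2_eq_square algebra_simps)
  have "2 dvd s * (s + 1)" by simp
  then have "4 * 2 dvd q - 1" unfolding q by (rule mult_dvd_mono[OF dvd_refl])
  then have "8 dvd CARD('a) - 1" using assms(5) by simp
  moreover have "CARD('a) > 1"
    using card_mono[of UNIV "{0, 1 :: 'a}"] by simp
  ultimately have "48 * real (num_cliques 3 (UNIV :: 'a set) (peisert_adj g))
      = real q * (real q - 1) * (real q - 5)"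
    using num_cliques_peisert[OF assms(6)] assms(5) by simp
  then show ?thesis by simp
qed

end
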